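(* Let $\Gamma$ be a discrete abelian group containing elements of arbitrarily large order. Then $\Gamma$ contains a quasi-independent set $\Lambda$ such that for every integer $k\ge 1$ there exists a $k$-mesh $M\subset\Gamma$ of height $1$ satisfying $$|\Lambda\cap M|\ \ge\ \tfrac14\, k\log_2 k .$$
   Context: Groups are written additively; $|S|$ denotes the cardinality of a set $S$; $\log_2$ is the logarithm in base $2$. Elements of infinite order count as having order larger than any integer. A subset $\Lambda$ of an abelian group $\Gamma$ is quasi-independent if every relation $\sum_{\gamma\in\Lambda}\varepsilon_\gamma\gamma=0$ (finite sum, i.e. only finitely many $\varepsilon_\gamma$ nonzero) with $\varepsilon_\gamma\in\{-1,0,1\}$ for all $\gamma\in\Lambda$ forces all $\varepsilon_\gamma=0$. For integers $k\ge1$, $h\ge 1$, a $k$-mesh of height $h$ in $\Gamma$ is a set of the form $$M=\Big\{\sum_{j=1}^k n_j\gamma_j : (n_1,\dots,n_k)\in E\Big\},$$ where $\gamma_1,\dots,\gamma_k\in\Gamma$ and $E\subset\mathbb{Z}^k$ is a set such that $|n_j|\le h$ for all $j$ and all $(n_1,\dots,n_k)\in E$. *)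

theory Defs
  imports Complex_Main "HOL-Algebra.Multiplicative_Group" "HOL-Library.FuncSet"
begin

text \<open>Abelian groups are written multiplicatively, as in the library: the multiple of an element
  \<open>x\<close> by an integer \<open>n\<close> is \<open>x [^] n\<close>, and sums are \<open>finprod\<close>.\<close>

text \<open>The library sets \<open>ord x = 0\<close> when \<open>x\<close> has infinite order, which counts here as larger
  than any integer.\<close>

definition arbitrarily_large_order :: "('a, 'b) monoid_scheme \<Rightarrow> bool" where
  "arbitrarily_large_order G \<longleftrightarrow>
     (\<forall>N::nat. \<exists>x\<in>carrier G. group.ord G x = 0 \<or> group.ord G x > N)"

text \<open>The sum over a possibly infinite \<open>\<Lambda>\<close> is taken over the finite support of the coefficients;
  \<open>finprod\<close> over an infinite set would be the unit.\<close>

definition quasi_independent :: "('a, 'b) monoid_scheme \<Rightarrow> 'a set \<Rightarrow> bool" where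
  "quasi_independent G \<Lambda> \<longleftrightarrow> \<Lambda> \<subseteq> carrier G \<and>
     (\<forall>\<epsilon> :: 'a \<Rightarrow> int.
        (\<forall>x\<in>\<Lambda>. \<epsilon> x \<in> {-1, 0, 1}) \<longrightarrow>
        finite {x\<in>\<Lambda>. \<epsilon> x \<noteq> 0} \<longrightarrow>
        finprod G (\<lambda>x. x [^]\<^bsub>G\<^esub> \<epsilon> x) {x\<in>\<Lambda>. \<epsilon> x \<noteq> 0} = \<one>\<^bsub>G\<^esub> \<longrightarrow>
        (\<forall>x\<in>\<Lambda>. \<epsilon> x = 0))"

text \<open>Elements of \<open>\<int>\<^sup>k\<close> are the extensional functions \<open>{1..k} \<rightarrow>\<^sub>E UNIV\<close>.\<close>

definition mesh :: "('a, 'b) monoid_scheme \<Rightarrow> nat \<Rightarrow> nat \<Rightarrow> 'a set \<Rightarrow> bool" where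
  "mesh G k h M \<longleftrightarrow> k \<ge> 1 \<and> h \<ge> 1 \<and>
     (\<exists>(\<gamma> :: nat \<Rightarrow> 'a) (E :: (nat \<Rightarrow> int) set).
        \<gamma> \<in> {1..k} \<rightarrow> carrier G \<and>
        E \<subseteq> {1..k} \<rightarrow>\<^sub>E UNIV \<and>
        (\<forall>n\<in>E. \<forall>j\<in>{1..k}. \<bar>n j\<bar> \<le> int h) \<and>
        M = {finprod G (\<lambda>j. \<gamma> j [^]\<^bsub>G\<^esub> n j) {1..k} | n. n \<in> E})"

end

theory Submission
  imports Defs "HOL-Library.Countable"
begin

text \<open>The matrices of Cantor and Mills, built by the doubling
  \<open>A \<mapsto> [[A, A, I], [A, -A, 0]]\<close>, have \<open>2 ^ m\<close> rows, \<open>(m + 2) * 2 ^ (m - 1)\<close> columns and entries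
  in \<open>{-1, 0, 1}\<close>, and their columns are quasi-independent. A greedy choice gives elements
  \<open>g (m, i)\<close> of the group admitting no nontrivial relation whose coefficients at \<open>(m, i)\<close> are
  bounded by the number of columns of the \<open>m\<close>-th matrix. The set \<open>\<Lambda>\<close> consists of the
  combinations of \<open>g (m, 0), \<dots>, g (m, 2 ^ m - 1)\<close> given by the columns of the \<open>m\<close>-th matrix,
  for all \<open>m\<close>; for \<open>2 ^ m \<le> k < 2 ^ (m + 1)\<close> the \<open>m\<close>-th block lies in a \<open>k\<close>-mesh.\<close>

section \<open>Detecting matrices\<close>

text \<open>Every integer vector bounded by 1 is a difference of two 0/1 vectors, so the second
  clause is injectivity of the matrix on 0/1 vectors.\<close>

definition detecting :: "nat \<Rightarrow> nat \<Rightarrow> (nat \<Rightarrow> nat \<Rightarrow> int) \<Rightarrow> bool" where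
  "detecting r c A \<longleftrightarrow>
     (\<forall>i<r. \<forall>j<c. \<bar>A i j\<bar> \<le> 1) \<and>
     (\<forall>e. (\<forall>j<c. \<bar>e j\<bar> \<le> 1) \<longrightarrow> (\<forall>i<r. (\<Sum>j<c. e j * A i j) = 0) \<longrightarrow> (\<forall>j<c. e j = 0))"

lemma sum_lessThan_add:
  fixes f :: "nat \<Rightarrow> 'a :: comm_monoid_add"
  shows "(\<Sum>j<m + n. f j) = (\<Sum>j<m. f j) + (\<Sum>j<n. f (m + j))"
  by (induction n) (simp_all add: add.assoc)

text \<open>With \<open>e\<close> cut into blocks u, v, w, the block rows read Au + Av + w = 0 and
  Au - Av = 0. Hence w = -2Au, which vanishes by parity and the bound 1, and then Au = Av =
  0.\<close>

lemma detecting_double: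
  assumes "detecting r c A"
  shows "\<exists>B. detecting (2 * r) (2 * c + r) B"
proof -
  \<comment> \<open>\<open>i mod r\<close> repeats \<open>A\<close> in both block rows. In the last
    block the column offset is below \<open>r\<close>, so rows from \<open>r\<close> on are zero
    there.\<close>
  define B where "B = (\<lambda>i j. if j < c then A (i mod r) j
    else if j < c + c then (if i < r then A i (j - c) else - A (i - r) (j - c))
    else if i = j - (c + c) then 1 else 0)"
  have A1: "\<bar>A i j\<bar> \<le> 1" if "i < r" "j < c" for i j
    using assms that by (auto simp: detecting_def)
  have A2: "e j = 0" if "\<forall>j<c. \<bar>e j\<bar> \<le> 1" "\<forall>i<r. (\<Sum>j<c. e j * A i j) = 0" "j < c" for e j
    using assms that by (auto simp: detecting_def)
  have "\<bar>B i j\<bar> \<le> 1" if "i < 2 * r" "j < 2 * c + r" for i j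
    using that A1[of "i mod r" j] A1[of i "j - c"] A1[of "i - r" "j - c"]
    by (auto simp: B_def)
  moreover have "e j = 0"
    if e: "\<forall>j<2 * c + r. \<bar>e j\<bar> \<le> 1" and z: "\<forall>i<2 * r. (\<Sum>j<2 * c + r. e j * B i j) = 0"
      and j: "j < 2 * c + r" for e j
  proof -
    have split: "(\<Sum>j<2 * c + r. e j * B i j) =
        (\<Sum>j<c. e j * B i j) + (\<Sum>j<c. e (c + j) * B i (c + j)) +
        (\<Sum>j<r. e (c + c + j) * B i (c + c + j))" for i
      unfolding mult_2 sum_lessThan_add by simp
    have top: "(\<Sum>j<c. e j * A i j) + (\<Sum>j<c. e (c + j) * A i j) + e (c + c + i) = 0"
      if "i < r" for i
    proof -
      have "(\<Sum>j<r. e (c + c + j) * B i (c + c + j)) = (\<Sum>j<r. if j = i then e (c + c + i) else 0)"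
        by (intro sum.cong) (auto simp: B_def)
      also have "\<dots> = e (c + c + i)"
        using that by simp
      finally show ?thesis
        using z[rule_format, of i] split[of i] that by (simp add: B_def)
    qed
    have bot: "(\<Sum>j<c. e j * A i j) = (\<Sum>j<c. e (c + j) * A i j)" if "i < r" for i
    proof -
      have "(\<Sum>j<r. e (c + c + j) * B (r + i) (c + c + j)) = 0"
        by (intro sum.neutral) (auto simp: B_def)
      then show ?thesis
        using z[rule_format, of "r + i"] split[of "r + i"] that
        by (simp add: B_def sum_negf)
    qed
    \<comment> \<open>Adding and subtracting the two block rows shows that the last block of \<open>e\<close> is even.\<close>
    have e3: "e (c + c + i) = 0" if "i < r" for i
      using top[OF that] bot[OF that] e[rule_format, of "c + c + i"] that by presburger
    have s: "(\<Sum>j<c. e j * A i j) = 0" "(\<Sum>j<c. e (c + j) * A i j) = 0" if "i < r" for i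
      using top[OF that] bot[OF that] e3[OF that] by linarith+
    have e1: "e j = 0" if "j < c" for j
      by (rule A2) (use e s that in auto)
    have e2: "e (c + j) = 0" if "j < c" for j
      by (rule A2[of "\<lambda>j. e (c + j)"]) (use e s that in auto)
    consider "j < c" | "c \<le> j" "j < c + c" | "c + c \<le> j" by linarith
    then show ?thesis
      using e1[of j] e2[of "j - c"] e3[of "j - (c + c)"] j by cases auto
  qed
  ultimately have "detecting (2 * r) (2 * c + r) B"
    unfolding detecting_def by blast
  then show ?thesis by blast
qed

text \<open>Doubling gives c' = 2c + 2^m. Stating the value of \<open>2 * c\<close> avoids the
  exponent \<open>m - 1\<close> at \<open>m = 0\<close>.\<close>

lemma ex_detecting:
  "\<exists>c A. 2 * c = (m + 2) * 2 ^ m \<and> detecting (2 ^ m) c A"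
proof (induction m)
  case 0
  have "detecting 1 1 (\<lambda>_ _. 1)"
    by (simp add: detecting_def)
  then show ?case by (intro exI[of _ 1]) auto
next
  case (Suc m)
  then obtain c A where "2 * c = (m + 2) * 2 ^ m" "detecting (2 ^ m) c A" by blast
  with detecting_double[of "2 ^ m" c A] show ?case
    by (intro exI[of _ "2 * c + 2 ^ m"]) (auto simp: algebra_simps)
qed

section \<open>Families without small relations\<close>

text \<open>Coefficients are bounded by a height \<open>H i\<close> that depends on the index; for \<open>H = 1\<close> this is
  quasi-independence, with repetitions excluded.\<close>

definition independent_upto ::
    "('a, 'b) monoid_scheme \<Rightarrow> 'i set \<Rightarrow> ('i \<Rightarrow> nat) \<Rightarrow> ('i \<Rightarrow> 'a) \<Rightarrow> bool" where
  "independent_upto G I H x \<longleftrightarrow> x \<in> I \<rightarrow> carrier G \<and>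
     (\<forall>J n. finite J \<longrightarrow> J \<subseteq> I \<longrightarrow> (\<forall>i\<in>J. \<bar>n i\<bar> \<le> int (H i)) \<longrightarrow>
        finprod G (\<lambda>i. x i [^]\<^bsub>G\<^esub> (n i :: int)) J = \<one>\<^bsub>G\<^esub> \<longrightarrow> (\<forall>i\<in>J. n i = 0))"

lemma independent_uptoD:
  assumes "independent_upto G I H x" "finite J" "J \<subseteq> I" "\<And>i. i \<in> J \<Longrightarrow> \<bar>n i\<bar> \<le> int (H i)"
    and "finprod G (\<lambda>i. x i [^]\<^bsub>G\<^esub> (n i :: int)) J = \<one>\<^bsub>G\<^esub>" "i \<in> J"
  shows "n i = 0"
  using assms unfolding independent_upto_def by blast

context comm_group
begin

section \<open>Finite products of integer powers\<close>

lemma finprod_int_pow_add: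
  assumes "x \<in> J \<rightarrow> carrier G"
  shows "(\<Otimes>i\<in>J. x i [^] (a i + b i :: int)) = (\<Otimes>i\<in>J. x i [^] a i) \<otimes> (\<Otimes>i\<in>J. x i [^] b i)"
proof -
  have "(\<Otimes>i\<in>J. x i [^] (a i + b i)) = (\<Otimes>i\<in>J. x i [^] a i \<otimes> x i [^] b i)"
    using assms by (intro finprod_cong') (auto simp: int_pow_mult Pi_iff)
  also have "\<dots> = (\<Otimes>i\<in>J. x i [^] a i) \<otimes> (\<Otimes>i\<in>J. x i [^] b i)"
    using assms by (intro finprod_multf) (auto simp: Pi_iff)
  finally show ?thesis .
qed

lemma finprod_int_pow_mult:
  assumes "x \<in> J \<rightarrow> carrier G" "finite J"
  shows "(\<Otimes>i\<in>J. x i [^] (a i * k :: int)) = (\<Otimes>i\<in>J. x i [^] a i) [^] k"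
  using assms(2,1)
proof (induction rule: finite_induct)
  case (insert j J)
  then have "(\<Otimes>i\<in>J. x i [^] a i) \<in> carrier G"
    by (intro finprod_closed) (auto simp: Pi_iff)
  with insert show ?case
    by (simp add: int_pow_distrib int_pow_pow Pi_iff)
qed simp

text \<open>Exchanging the products turns a relation between combinations of the \<open>x i\<close>
  into one between the \<open>x i\<close> themselves.\<close>

lemma finprod_int_pow_sum:
  assumes "x \<in> J \<rightarrow> carrier G" "finite J" "finite Q"
  shows "(\<Otimes>i\<in>J. x i [^] (\<Sum>q\<in>Q. a q i * e q :: int)) = (\<Otimes>q\<in>Q. (\<Otimes>i\<in>J. x i [^] a q i) [^] e q)"
  using assms(3)
proof (induction rule: finite_induct)
  case (insert q Q)
  have "(\<Otimes>i\<in>J. x i [^] a q i) \<in> carrier G" for q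
    using assms by (intro finprod_closed) (auto simp: Pi_iff)
  with insert show ?case
    using assms by (simp add: finprod_int_pow_add finprod_int_pow_mult)
qed (simp add: finprod_one_eqI)

section \<open>Greedy choice of the elements\<close>

text \<open>Pigeonhole on the powers of one \<open>x\<close> of large order: if every
  \<open>x [^] t\<close> fails, each \<open>t\<close> yields a pair in the finite set
  \<open>P\<close>. Two exponents with the same pair make \<open>(t - s) * n t\<close> a nonzero
  multiple of \<open>ord x\<close> that is too small.\<close>

lemma ex_multiples_avoiding:
  fixes H :: nat
  assumes large: "arbitrarily_large_order G" and S: "finite S"
  shows "\<exists>y\<in>carrier G. \<forall>n::int. n \<noteq> 0 \<longrightarrow> \<bar>n\<bar> \<le> int H \<longrightarrow> y [^] n \<notin> S"
proof (rule ccontr)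
  define P where "P = {- int H..int H} \<times> S"
  have P: "finite P" using S by (simp add: P_def)
  \<comment> \<open>The exponents will run over \<open>{..card P}\<close>, one more than
    \<open>P\<close> has elements, so \<open>H * card P\<close> bounds every
    \<open>\<bar>(t - s) * n t\<bar>\<close>.\<close>
  obtain x where x: "x \<in> carrier G" "ord x = 0 \<or> ord x > H * card P"
    using large unfolding arbitrarily_large_order_def by blast
  assume "\<not> ?thesis"
  then have "\<forall>t::nat. \<exists>n. n \<noteq> 0 \<and> \<bar>n\<bar> \<le> int H \<and> (x [^] t) [^] n \<in> S"
    using x by auto
  then obtain n where n: "\<And>t. n t \<noteq> 0" "\<And>t. \<bar>n t\<bar> \<le> int H" "\<And>t::nat. (x [^] t) [^] n t \<in> S"
    by metis
  define f where "f t = (n t, (x [^] t) [^] n t)" for t :: nat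
  have "f ` {..card P} \<subseteq> P"
  proof (intro image_subsetI)
    show "f t \<in> P" for t
      using n(2,3)[of t] by (auto simp: f_def P_def)
  qed
  then have "card (f ` {..card P}) < card {..card P}"
    using card_mono[OF P] by (simp add: le_imp_less_Suc)
  then obtain s t where st: "s \<le> card P" "t \<le> card P" "s < t" "f s = f t"
    using pigeonhole[of f "{..card P}"] unfolding inj_on_def by (metis atMost_iff linorder_neqE_nat)
  then have "x [^] (int s * n t) = x [^] (int t * n t)"
    using x unfolding f_def prod.inject by (metis int_pow_int int_pow_pow)
  then have "int (ord x) dvd int t * n t - int s * n t"
    using x int_pow_eq by blast
  then have dvd: "int (ord x) dvd (int t - int s) * n t"
    by (simp add: algebra_simps)
  have nz: "(int t - int s) * n t \<noteq> 0"
    using n st by simp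
  have "\<bar>(int t - int s) * n t\<bar> \<le> int (card P) * int H"
    unfolding abs_mult using n st by (intro mult_mono) auto
  moreover have "int (ord x) \<le> \<bar>(int t - int s) * n t\<bar>"
    using dvd_imp_le_int[OF nz dvd] by simp
  ultimately have "int (ord x) \<le> int (H * card P)"
    by (simp add: mult.commute)
  \<comment> \<open>If \<open>ord x = 0\<close>, divisibility by 0 already contradicts
    \<open>nz\<close>.\<close>
  with x(2) dvd nz show False by auto
qed

text \<open>Each \<open>g i\<close> is chosen so that its small nonzero multiples avoid the finite
  set of small combinations of earlier elements. A nontrivial relation, solved for its last term,
  violates this choice.\<close>

lemma ex_independent_upto_nat:
  fixes H :: "nat \<Rightarrow> nat"
  assumes "arbitrarily_large_order G"
  shows "\<exists>g. independent_upto G UNIV H g"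
proof -
  \<comment> \<open>\<open>restrict\<close> makes \<open>S g i\<close> depend on the values of \<open>g\<close> below \<open>i\<close> only: \<open>finprod_cong\<close>
    applies to families in the carrier alone.\<close>
  define S where "S g i = (\<lambda>n. \<Otimes>j\<in>{..<i}. restrict g {..<i} j [^] (n j :: int)) ` (\<Pi>\<^sub>E j\<in>{..<i}. {- int (H j)..int (H j)})"
    for g i
  define P where "P g i y \<longleftrightarrow> y \<in> carrier G \<and>
    (\<forall>n::int. n \<noteq> 0 \<longrightarrow> \<bar>n\<bar> \<le> int (H i) \<longrightarrow> y [^] n \<notin> S g i)" for g i y
  have "\<exists>g. \<forall>i. P g i (g i)"
  proof (rule dependent_wf_choice)
    show "wf less_than" by simp
    show "P f i y = P g i y" if "\<And>z. (z, i) \<in> less_than \<Longrightarrow> f z = g z" for f g i y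
    proof -
      have "restrict f {..<i} = restrict g {..<i}"
        using that by (intro restrict_ext) auto
      then show ?thesis by (simp only: P_def S_def)
    qed
    show "\<exists>y. P g i y" for g i
    proof -
      have "finite (S g i)"
        unfolding S_def by (intro finite_imageI finite_PiE) auto
      from ex_multiples_avoiding[OF assms this, of "H i"] show ?thesis
        unfolding P_def by blast
    qed
  qed
  then obtain g where g: "\<And>i. P g i (g i)" by blast
  then have closed: "g i \<in> carrier G" for i by (simp add: P_def)
  have "\<forall>i\<in>J. n i = 0"
    if J: "finite J" and n: "\<forall>i\<in>J. \<bar>n i\<bar> \<le> int (H i)" and one: "(\<Otimes>i\<in>J. g i [^] n i) = \<one>"
    for J and n :: "nat \<Rightarrow> int"
  proof (rule ccontr)
    define K where "K = {i\<in>J. n i \<noteq> 0}"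
    define k where "k = Max K"
    \<comment> \<open>The sign flips because the relation is solved for \<open>g k [^] n k\<close>;
      the value 0 off \<open>K\<close> lets the product run over all of \<open>{..<k}\<close>, as in
      \<open>S g k\<close>.\<close>
    define n' where "n' = (\<lambda>j. if j \<in> K then - n j else 0)"
    assume "\<not> ?thesis"
    with J have K: "finite K" "K \<noteq> {}" by (auto simp: K_def)
    then have k: "k \<in> K" "\<And>i. i \<in> K \<Longrightarrow> i \<le> k" by (auto simp: k_def)
    have bound: "n' i \<in> {- int (H i)..int (H i)}" for i
      using n[rule_format, of i] by (auto simp: n'_def K_def)
    have "(\<Otimes>i\<in>J. g i [^] n i) = (\<Otimes>i\<in>{..k}. g i [^] (- n' i))"
      using J k closed by (intro finprod_mono_neutral_cong) (auto simp: n'_def K_def dest: k(2)[unfolded K_def, OF CollectI, OF conjI])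
    also have "{..k} = insert k {..<k}" by auto
    also have "(\<Otimes>i\<in>insert k {..<k}. g i [^] (- n' i)) =
        g k [^] n k \<otimes> (\<Otimes>i\<in>{..<k}. g i [^] (- n' i))"
      using closed k by (simp add: n'_def)
    finally have "g k [^] n k \<otimes> (\<Otimes>i\<in>{..<k}. g i [^] (- n' i)) = \<one>"
      using one by simp
    moreover have "(\<Otimes>i\<in>{..<k}. g i [^] n' i) \<otimes> (\<Otimes>i\<in>{..<k}. g i [^] (- n' i)) = \<one>"
      using closed by (simp flip: finprod_int_pow_add)
    ultimately have "g k [^] n k \<otimes> (\<Otimes>i\<in>{..<k}. g i [^] (- n' i)) =
        (\<Otimes>i\<in>{..<k}. g i [^] n' i) \<otimes> (\<Otimes>i\<in>{..<k}. g i [^] (- n' i))"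
      by simp
    then have "g k [^] n k = (\<Otimes>i\<in>{..<k}. g i [^] n' i)"
      using closed by (subst (asm) right_cancel) auto
    also have "\<dots> = (\<Otimes>i\<in>{..<k}. restrict g {..<k} i [^] restrict n' {..<k} i)"
      using closed by (intro finprod_cong') auto
    also have "\<dots> \<in> S g k"
      unfolding S_def by (intro imageI restrict_PiE_iff[THEN iffD2] ballI bound)
    finally show False
      using g[of k] k n by (auto simp: P_def K_def)
  qed
  then have "independent_upto G UNIV H g"
    using closed by (auto simp: independent_upto_def)
  then show ?thesis by blast
qed

text \<open>Relations are transported along \<open>to_nat\<close>; the heights fit because
  \<open>from_nat\<close> undoes \<open>to_nat\<close>.\<close>

lemma ex_independent_upto:
  fixes H :: "'i::countable \<Rightarrow> nat"
  assumes "arbitrarily_large_order G"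
  shows "\<exists>g. independent_upto G UNIV H g"
proof -
  obtain g where g: "independent_upto G UNIV (H \<circ> from_nat) g"
    using ex_independent_upto_nat[OF assms] by blast
  then have closed: "g i \<in> carrier G" for i by (auto simp: independent_upto_def)
  have "n i = 0"
    if "finite J" "\<forall>i\<in>J. \<bar>n i\<bar> \<le> int (H i)" "(\<Otimes>i\<in>J. g (to_nat i) [^] n i) = \<one>" "i \<in> J"
    for J n and i :: 'i
  proof -
    have "(\<Otimes>j\<in>to_nat ` J. g j [^] (n \<circ> from_nat) j) = (\<Otimes>i\<in>J. g (to_nat i) [^] n i)"
      using closed by (subst finprod_reindex) (auto simp: inj_on_def)
    with that have "(n \<circ> from_nat) (to_nat i) = 0"
      by (intro independent_uptoD[OF g, of "to_nat ` J"]) auto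
    then show ?thesis by simp
  qed
  then have "independent_upto G UNIV H (g \<circ> to_nat)"
    using closed by (auto simp: independent_upto_def)
  then show ?thesis by blast
qed

section \<open>From independent families to quasi-independent sets\<close>

text \<open>A repeated value would give a relation with coefficients 1 and -1.\<close>

lemma independent_upto_1_inj_on:
  assumes "independent_upto G I (\<lambda>_. 1) x"
  shows "inj_on x I"
proof (rule inj_onI, rule ccontr)
  fix p q assume pq: "p \<in> I" "q \<in> I" "x p = x q" "p \<noteq> q"
  define n :: "'c \<Rightarrow> int" where "n = (\<lambda>i. if i = p then 1 else -1)"
  have c: "x p \<in> carrier G" "x q \<in> carrier G"
    using assms pq by (auto simp: independent_upto_def)
  have "(\<Otimes>i\<in>{p, q}. x i [^] n i) = x p [^] n p \<otimes> x q [^] n q"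
    using pq c by simp
  also have "\<dots> = \<one>"
    using pq c by (simp add: n_def int_pow_neg)
  finally have "n p = 0"
    by (intro independent_uptoD[OF assms, of "{p, q}"]) (use pq in \<open>auto simp: n_def\<close>)
  then show False by (simp add: n_def)
qed

lemma independent_upto_1_quasi_independent:
  assumes "independent_upto G I (\<lambda>_. 1) x"
  shows "quasi_independent G (x ` I)"
  unfolding quasi_independent_def
proof (intro conjI allI impI)
  have closed: "x \<in> I \<rightarrow> carrier G" using assms by (simp add: independent_upto_def)
  then show "x ` I \<subseteq> carrier G" by auto
  fix e :: "'a \<Rightarrow> int"
  define K where "K = {i\<in>I. e (x i) \<noteq> 0}"
  have K: "{y\<in>x ` I. e y \<noteq> 0} = x ` K" by (auto simp: K_def)
  have inj: "inj_on x K"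
    using independent_upto_1_inj_on[OF assms] by (rule inj_on_subset) (auto simp: K_def)
  assume e: "\<forall>y\<in>x ` I. e y \<in> {-1, 0, 1}" and fin: "finite {y\<in>x ` I. e y \<noteq> 0}"
    and one: "(\<Otimes>y\<in>{y\<in>x ` I. e y \<noteq> 0}. y [^] e y) = \<one>"
  have "finite K"
    using fin inj unfolding K by (simp add: finite_image_iff)
  moreover have "(\<Otimes>i\<in>K. x i [^] e (x i)) = \<one>"
    using one inj closed unfolding K by (subst (asm) finprod_reindex) (auto simp: K_def)
  ultimately have "e (x i) = 0" if "i \<in> K" for i
    using that e by (intro independent_uptoD[OF assms, of K "\<lambda>i. e (x i)"]) (auto simp: K_def)
  then show "\<forall>y\<in>x ` I. e y = 0" by (auto simp: K_def)
qed

text \<open>A relation \<open>e\<close> between columns expands to one between the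
  \<open>g (m, i)\<close>, with coefficients the entries of \<open>A m\<close> applied to block
  \<open>m\<close> of \<open>e\<close>. Each is a sum of \<open>c m\<close> terms of size at most 1,
  so the height \<open>c m\<close> forces it to vanish; then \<open>detecting\<close> kills
  \<open>e\<close> block by block.\<close>

lemma independent_upto_columns:
  fixes c :: "'m \<Rightarrow> nat"
  assumes A: "\<And>m. detecting (r m) (c m) (A m)"
    and g: "independent_upto G UNIV (\<lambda>(m, i). c m) g"
  shows "independent_upto G (SIGMA m:UNIV. {..<c m}) (\<lambda>_. 1)
           (\<lambda>(m, j). \<Otimes>i\<in>{..<r m}. g (m, i) [^] A m i j)"
proof -
  have closed: "g p \<in> carrier G" for p using g by (auto simp: independent_upto_def)
  define x where "x = (\<lambda>(m, j). \<Otimes>i\<in>{..<r m}. g (m, i) [^] A m i j)"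
  have x_closed: "x q \<in> carrier G" for q
    by (cases q) (simp add: x_def closed)
  \<comment> \<open>The block diagonal matrix with blocks \<open>A m\<close>: column
    \<open>(m, j)\<close>, row \<open>(m', i)\<close>.\<close>
  define a where "a = (\<lambda>(m, j) (m', i). if m' = m then A m i j else 0)"
  have "e q = 0"
    if J: "finite J" "J \<subseteq> (SIGMA m:UNIV. {..<c m})" and e: "\<forall>q\<in>J. \<bar>e q\<bar> \<le> 1"
      and one: "(\<Otimes>q\<in>J. x q [^] e q) = \<one>" and q: "q \<in> J" for J q and e :: "'m \<times> nat \<Rightarrow> int"
  proof -
    define P where "P = (SIGMA m:fst ` J. {..<r m})"
    define n where "n p = (\<Sum>q\<in>J. a q p * e q)" for p
    \<comment> \<open>Extension by 0, since \<open>detecting\<close> speaks of all columns of a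
      block while \<open>J\<close> may contain only some.\<close>
    define e' where "e' q = (if q \<in> J then e q else 0)" for q
    have fin: "finite P" using J by (auto simp: P_def)
    have x_eq: "x q = (\<Otimes>p\<in>P. g p [^] a q p)" if "q \<in> J" for q
    proof -
      obtain m j where mj: "q = (m, j)" by fastforce
      have "x q = (\<Otimes>i\<in>{..<r m}. g (m, i) [^] a q (m, i))"
        by (simp add: x_def a_def mj)
      also have "\<dots> = (\<Otimes>p\<in>Pair m ` {..<r m}. g p [^] a q p)"
        using closed by (subst finprod_reindex) (auto simp: inj_on_def)
      also have "\<dots> = (\<Otimes>p\<in>P. g p [^] a q p)"
        using closed fin that
        by (intro finprod_mono_neutral_cong_left) (force simp: P_def a_def mj)+
      finally show ?thesis .
    qed
    have "(\<Otimes>p\<in>P. g p [^] n p) = (\<Otimes>q\<in>J. (\<Otimes>p\<in>P. g p [^] a q p) [^] e q)"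
      unfolding n_def using closed fin J by (intro finprod_int_pow_sum) auto
    also have "\<dots> = \<one>"
      unfolding one[symmetric] using x_closed by (intro finprod_cong') (auto simp: x_eq)
    finally have prod: "(\<Otimes>p\<in>P. g p [^] n p) = \<one>" .
    have n_eq: "n (m, i) = (\<Sum>j<c m. e' (m, j) * A m i j)" for m i
    proof -
      have "n (m, i) = (\<Sum>q\<in>J \<inter> Pair m ` {..<c m}. a q (m, i) * e q)"
        unfolding n_def using J by (intro sum.mono_neutral_right) (auto simp: a_def split: if_splits)
      also have "\<dots> = (\<Sum>q\<in>Pair m ` {..<c m}. a q (m, i) * e' q)"
        by (intro sum.mono_neutral_cong_left) (auto simp: e'_def)
      also have "\<dots> = (\<Sum>j<c m. e' (m, j) * A m i j)"
        by (subst sum.reindex) (auto simp: inj_on_def a_def mult.commute)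
      finally show ?thesis .
    qed
    have e': "\<bar>e' q\<bar> \<le> 1" for q using e by (simp add: e'_def)
    have bound: "\<bar>n (m, i)\<bar> \<le> int (c m)" if "i < r m" for m i
    proof -
      have "\<bar>e' (m, j) * A m i j\<bar> \<le> 1" if "j < c m" for j
        unfolding abs_mult using A[of m] that \<open>i < r m\<close> e'
        by (intro mult_le_one) (auto simp: detecting_def)
      then have "(\<Sum>j<c m. \<bar>e' (m, j) * A m i j\<bar>) \<le> (\<Sum>j<c m. 1)"
        by (intro sum_mono) auto
      then have "(\<Sum>j<c m. \<bar>e' (m, j) * A m i j\<bar>) \<le> int (c m)"
        by simp
      then show ?thesis
        unfolding n_eq by (rule order_trans[OF sum_abs])
    qed
    have zero: "n p = 0" if "p \<in> P" for p
      using g fin _ _ prod that by (rule independent_uptoD) (auto simp: P_def bound)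
    obtain m j where mj: "q = (m, j)" by fastforce
    \<comment> \<open>All rows of block \<open>m\<close> lie in \<open>P\<close>, because
      \<open>q = (m, j)\<close> lies in \<open>J\<close>.\<close>
    have "\<forall>i<r m. (\<Sum>j<c m. e' (m, j) * A m i j) = 0"
      using zero q unfolding n_eq[symmetric] by (force simp: P_def mj)
    then have "\<forall>j<c m. e' (m, j) = 0"
      using A[of m] e' unfolding detecting_def by (auto dest!: spec[of _ "\<lambda>j. e' (m, j)"])
    with q J show ?thesis by (auto simp: e'_def mj)
  qed
  with x_closed show ?thesis
    unfolding independent_upto_def x_def[symmetric] by (auto simp: Pi_iff)
qed

section \<open>Meshes and the count\<close>

text \<open>Rows are numbered from 0 and mesh generators from 1, hence the shift; the
  \<open>k - r\<close> surplus generators get coefficient 0.\<close>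

lemma finprod_mem_full_mesh:
  fixes \<gamma> :: "nat \<Rightarrow> 'a" and a :: "nat \<Rightarrow> int"
  assumes "\<And>j. \<gamma> j \<in> carrier G" "r \<le> k" "\<And>i. i < r \<Longrightarrow> \<bar>a i\<bar> \<le> int h"
  shows "(\<Otimes>i\<in>{..<r}. \<gamma> i [^] a i) \<in>
    {\<Otimes>j\<in>{1..k}. \<gamma> (j - 1) [^] n j | n. n \<in> {1..k} \<rightarrow>\<^sub>E {- int h..int h}}"
proof -
  define n where "n = (\<lambda>j\<in>{1..k}. if j \<le> r then a (j - 1) else 0)"
  have "(\<Otimes>i\<in>{..<r}. \<gamma> i [^] a i) = (\<Otimes>i\<in>{..<r}. \<gamma> (Suc i - 1) [^] n (Suc i))"
    using assms by (intro finprod_cong') (auto simp: n_def)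
  also have "\<dots> = (\<Otimes>j\<in>Suc ` {..<r}. \<gamma> (j - 1) [^] n j)"
    using assms by (subst finprod_reindex) auto
  also have "\<dots> = (\<Otimes>j\<in>{1..k}. \<gamma> (j - 1) [^] n j)"
  proof (rule finprod_mono_neutral_cong_left)
    show "\<gamma> (i - 1) [^] n i = \<one>" if "i \<in> {1..k} - Suc ` {..<r}" for i
    proof -
      have "\<not> i \<le> r" using that by (auto simp: image_Suc_lessThan)
      then show ?thesis using that by (simp add: n_def)
    qed
  qed (use assms in auto)
  finally have "(\<Otimes>i\<in>{..<r}. \<gamma> i [^] a i) = (\<Otimes>j\<in>{1..k}. \<gamma> (j - 1) [^] n j)" .
  moreover have "(if j \<le> r then a (j - 1) else 0) \<in> {- int h..int h}" if "j \<in> {1..k}" for j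
    using assms(3)[of "j - 1"] that by (cases "j \<le> r") fastforce+
  then have "n \<in> {1..k} \<rightarrow>\<^sub>E {- int h..int h}"
    by (simp add: n_def)
  ultimately show ?thesis by blast
qed

lemma mesh_full:
  fixes \<gamma> :: "nat \<Rightarrow> 'a"
  assumes "\<And>j. \<gamma> j \<in> carrier G" "k \<ge> 1" "h \<ge> 1"
  shows "mesh G k h {\<Otimes>j\<in>{1..k}. \<gamma> (j - 1) [^] n j | n. n \<in> {1..k} \<rightarrow>\<^sub>E {- int h..int h}}"
proof -
  have "\<bar>n j\<bar> \<le> int h" if "n \<in> {1..k} \<rightarrow>\<^sub>E {- int h..int h}" "j \<in> {1..k}" for n j
    using PiE_mem[OF that] by auto
  then show ?thesis
    unfolding mesh_def
    by (intro conjI exI[of _ "\<lambda>j. \<gamma> (j - 1)"] exI[of _ "{1..k} \<rightarrow>\<^sub>E {- int h..int h}"])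
      (use assms in \<open>auto intro: PiE_mono\<close>)
qed

end

text \<open>k log k is at most 2^(m+1) (m+1), which is at most 2^(m+1) (m+2) = 4c; this is the
  source of the factor 1/4.\<close>

lemma quarter_k_log_k_le:
  fixes k m c :: nat
  assumes "2 ^ m \<le> k" "k < 2 ^ (m + 1)" "2 * c = (m + 2) * 2 ^ m"
  shows "1 / 4 * (real k * log 2 (real k)) \<le> real c"
proof -
  have k: "1 \<le> real k"
    using assms(1) one_le_power[of "2::nat" m] by linarith
  have kr: "real k \<le> 2 ^ (m + 1)"
    using assms(2) by (metis less_imp_le of_nat_le_iff of_nat_numeral of_nat_power)
  then have "log 2 (real k) \<le> log 2 (2 ^ (m + 1))"
    using k by (subst log_le_cancel_iff) auto
  also have "\<dots> = real (m + 1)"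
    by (rule log_pow_cancel) auto
  finally have "log 2 (real k) \<le> real (m + 1)" .
  with kr k have "real k * log 2 (real k) \<le> 2 ^ (m + 1) * real (m + 1)"
    by (intro mult_mono) auto
  also have "\<dots> \<le> 2 * (real (m + 2) * 2 ^ m)"
    by (simp add: algebra_simps)
  also have "real (m + 2) * 2 ^ m = real ((m + 2) * 2 ^ m)" by (simp add: distrib_right)
  also have "\<dots> = 2 * real c" unfolding assms(3)[symmetric] by simp
  finally show ?thesis by simp
qed

theorem mainTheorem1:
  fixes \<Gamma> :: "('a, 'b) monoid_scheme"
  assumes "comm_group \<Gamma>"
    and "arbitrarily_large_order \<Gamma>"
  shows "\<exists>\<Lambda>. quasi_independent \<Gamma> \<Lambda> \<and>
           (\<forall>k::nat. k \<ge> 1 \<longrightarrow>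
              (\<exists>M. mesh \<Gamma> k 1 M \<and>
                   real (card (\<Lambda> \<inter> M)) \<ge> 1 / 4 * (real k * log 2 (real k))))"
proof -
  interpret comm_group \<Gamma> by fact
  obtain c A where c: "\<And>m. 2 * c m = (m + 2) * 2 ^ m"
    and A: "\<And>m. detecting (2 ^ m) (c m) (A m)"
    using ex_detecting by metis
  obtain g :: "nat \<times> nat \<Rightarrow> 'a" where g: "independent_upto \<Gamma> UNIV (\<lambda>(m, i). c m) g"
    using ex_independent_upto[OF assms(2)] by blast
  then have closed: "g p \<in> carrier \<Gamma>" for p by (auto simp: independent_upto_def)
  define I where "I = (SIGMA m:UNIV. {..<c m})"
  define x where "x = (\<lambda>(m, j). finprod \<Gamma> (\<lambda>i. g (m, i) [^]\<^bsub>\<Gamma>\<^esub> A m i j) {..<2 ^ m})"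
  have x: "independent_upto \<Gamma> I (\<lambda>_. 1) x"
    unfolding I_def x_def using A g by (rule independent_upto_columns)
  show ?thesis
  proof (rule exI[of _ "x ` I"], intro conjI allI impI)
    show "quasi_independent \<Gamma> (x ` I)"
      using x by (rule independent_upto_1_quasi_independent)
    fix k :: nat assume k: "k \<ge> 1"
    \<comment> \<open>The largest block whose \<open>2 ^ m\<close> generators fit among
      \<open>k\<close>.\<close>
    obtain m where m: "2 ^ m \<le> k" "k < 2 ^ (m + 1)"
      using ex_power_ivl1[of 2 k] k by auto
    define E :: "(nat \<Rightarrow> int) set" where "E = {1..k} \<rightarrow>\<^sub>E {- int 1..int 1}"
    define M where "M = {finprod \<Gamma> (\<lambda>j. g (m, j - 1) [^]\<^bsub>\<Gamma>\<^esub> n j) {1..k} | n. n \<in> E}"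
    \<comment> \<open>Finiteness matters: \<open>card\<close> of an infinite intersection would be
      0.\<close>
    have "finite M"
      unfolding M_def E_def by (simp add: finite_PiE)
    have "x (m, j) \<in> M" if "j < c m" for j
      using finprod_mem_full_mesh[of "\<lambda>i. g (m, i)" "2 ^ m" k "\<lambda>i. A m i j" 1] A[of m] m that closed
      by (simp add: x_def M_def E_def detecting_def)
    then have "x ` Pair m ` {..<c m} \<subseteq> x ` I \<inter> M"
      by (auto simp: I_def)
    then have "card (x ` Pair m ` {..<c m}) \<le> card (x ` I \<inter> M)"
      using \<open>finite M\<close> by (intro card_mono) auto
    \<comment> \<open>Distinct columns give distinct elements, so the block contributes exactly
      \<open>c m\<close> of them.\<close>
    moreover have "inj_on x (Pair m ` {..<c m})"
      using independent_upto_1_inj_on[OF x] by (rule inj_on_subset) (auto simp: I_def)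
    then have "card (x ` Pair m ` {..<c m}) = c m"
      by (simp add: card_image inj_on_def)
    moreover have "1 / 4 * (real k * log 2 (real k)) \<le> real (c m)"
      using m c by (rule quarter_k_log_k_le)
    moreover have "mesh \<Gamma> k 1 M"
      using mesh_full[of "\<lambda>i. g (m, i)" k 1] closed k by (simp add: M_def E_def)
    ultimately show "\<exists>M. mesh \<Gamma> k 1 M \<and>
        1 / 4 * (real k * log 2 (real k)) \<le> real (card (x ` I \<inter> M))"
      by (intro exI[of _ M]) auto
  qed
qed

end
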